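(* Let $\pi$ be a Poisson structure on $\mathbb{R}^k$ that is weight homogeneous with respect to a weight vector $\overline{\omega}$, let $C=\mathbb{R}^r\subset\mathbb{R}^k$ be a coisotropic (coordinate) subspace, and let $F,G\in C^\infty(\mathbb{R}^r)$ be weight homogeneous with respect to $\overline{\omega}$. If $\Gamma\in\mathbf{Q}^{(2)}_{n,2}$, then $B_\Gamma(F,G)$ is weight homogeneous and $$\overline{\omega}(B_\Gamma(F,G))=\overline{\omega}(F)+\overline{\omega}(G)+n\cdot\overline{\omega}(\pi).$$
   Context: **Weights.** $\mathbb{R}^k$ has coordinates $x_1,\dots,x_k$ and $\overline{\omega}=(\overline{\omega}_1,\dots,\overline{\omega}_k)$ is a $k$-tuple of positive integers (weight vector). A smooth function $F$ is weight homogeneous of weight $\overline{\omega}(F)=w$ if $F(\lambda^{\overline{\omega}_1}x_1,\dots,\lambda^{\overline{\omega}_k}x_k)=\lambda^{w}F(x_1,\dots,x_k)$ for all $\lambda$; equivalently $E_{\overline\omega}F=wF$ with $E_{\overline\omega}=\sum_i\overline{\omega}_ix_i\partial_{x_i}$. A bivector field $\pi$ is weight homogeneous of weight $\overline{\omega}(\pi)$ if $\mathcal{L}_{E_{\overline\omega}}\pi=\overline{\omega}(\pi)\pi$; then $\{F,G\}$ has weight $\overline{\omega}(\pi)+\overline{\omega}(F)+\overline{\omega}(G)$ for weight homogeneous $F,G$. Convention: the zero function is regarded as weight homogeneous of every weight, so weight formulas are understood as "either the function is $0$ or it has this weight". **Coisotropic subspace.** $C=\{x_{r+1}=\dots=x_k=0\}\cong\mathbb{R}^r$,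 with coordinates $x_1,\dots,x_r$; functions on $C$ are viewed as functions on $\mathbb{R}^k$ independent of $x_{r+1},\dots,x_k$. Weights of functions on $C$ are taken with respect to $(\overline\omega_1,\dots,\overline\omega_r)$. **Graphs.** $\mathbf{Q}^{(2)}_{n,2}$ is the set of oriented graphs $\Gamma$ with ordered type I vertices $1,\dots,n$ and two type II vertices (to which $F$ and $G$ are associated). Each type I vertex $r$ is the source of exactly two ordered edges $e^1_r,e^2_r$; edges end at type I or type II vertices; type II vertices emit no edges. There are no loops, each edge has a colour $+$ or $-$, and no two edges have the same colour, source and target. **Operator.** A label $L$ assigns to every $+$ edge one of the coordinates $x_1,\dots,x_r$ and to every $-$ edge one of the coordinates $x_{r+1},\dots,x_k$. Then $$B_\Gamma(F,G)=\sum_{L}\left[\prod_{r=1}^{n}\Big(\prod_{\delta=(\cdot,r)}\partial_{L(\delta)}\Big)\{L(e_r^1),L(e_r^2)\}\right]\Big(\prod_{\delta=(\cdot,F)}\partial_{L(\delta)}\Big)(F)\ \Big(\prod_{\delta=(\cdot,G)}\partial_{L(\delta)}\Big)(G),$$ restricted to $C$, where $\delta=(\cdot,v)$ runs over the edges of $\Gamma$ ending at $v$, and $\{\cdot,\cdot\}$ is the Poisson bracket of $\pi$. *)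

theory Defs
  imports "HOL-Analysis.Analysis"
begin

section \<open>Smooth functions\<close>

definition partial_deriv :: "'k \<Rightarrow> (real^'k \<Rightarrow> real) \<Rightarrow> real^'k \<Rightarrow> real" where
  "partial_deriv i f x = deriv (\<lambda>t. f (x + t *\<^sub>R axis i 1)) 0"

definition partial_derivs :: "'k list \<Rightarrow> (real^'k \<Rightarrow> real) \<Rightarrow> real^'k \<Rightarrow> real" where
  "partial_derivs is f = foldr partial_deriv is f"

definition smooth :: "(real^'k \<Rightarrow> real) \<Rightarrow> bool" where
  "smooth f \<longleftrightarrow> (\<forall>is x. partial_derivs is f differentiable (at x))"

section \<open>Poisson structures\<close>

text \<open>A bivector field is given by its components in the standard coordinates:
  \<open>\<pi> i j = {x_i, x_j}\<close>, that is, the field is one half of the sum over all \<open>i\<close>, \<open>j\<close>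
  of \<open>\<pi> i j\<close> times the wedge of the \<open>i\<close>-th and \<open>j\<close>-th coordinate vector fields.\<close>

type_synonym 'k bivector = "'k \<Rightarrow> 'k \<Rightarrow> real^'k \<Rightarrow> real"

definition bivector_field :: "('k::finite) bivector \<Rightarrow> bool" where
  "bivector_field \<pi> \<longleftrightarrow> (\<forall>i j. smooth (\<pi> i j)) \<and> (\<forall>i j x. \<pi> i j x = - \<pi> j i x)"

definition bracket ::
  "('k::finite) bivector \<Rightarrow> (real^'k \<Rightarrow> real) \<Rightarrow> (real^'k \<Rightarrow> real) \<Rightarrow> real^'k \<Rightarrow> real" where
  "bracket \<pi> f g x = (\<Sum>i\<in>UNIV. \<Sum>j\<in>UNIV. \<pi> i j x * partial_deriv i f x * partial_deriv j g x)"

definition poisson_structure :: "('k::finite) bivector \<Rightarrow> bool" where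
  "poisson_structure \<pi> \<longleftrightarrow> bivector_field \<pi> \<and>
     (\<forall>f g h x. smooth f \<longrightarrow> smooth g \<longrightarrow> smooth h \<longrightarrow>
        bracket \<pi> f (bracket \<pi> g h) x + bracket \<pi> g (bracket \<pi> h f) x
          + bracket \<pi> h (bracket \<pi> f g) x = 0)"

text \<open>A subset is coisotropic if the functions vanishing on it are closed under the bracket.\<close>

definition coisotropic :: "('k::finite) bivector \<Rightarrow> (real^'k) set \<Rightarrow> bool" where
  "coisotropic \<pi> C \<longleftrightarrow>
     (\<forall>f g. smooth f \<longrightarrow> smooth g \<longrightarrow> (\<forall>x\<in>C. f x = 0) \<longrightarrow> (\<forall>x\<in>C. g x = 0) \<longrightarrow>
        (\<forall>x\<in>C. bracket \<pi> f g x = 0))"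

section \<open>Weights\<close>

definition dilation :: "('k \<Rightarrow> nat) \<Rightarrow> real \<Rightarrow> real^'k \<Rightarrow> real^'k" where
  "dilation \<omega> c x = (\<chi> i. c ^ \<omega> i * x $ i)"

definition euler_field :: "('k \<Rightarrow> nat) \<Rightarrow> real^'k \<Rightarrow> real^'k" where
  "euler_field \<omega> x = (\<chi> i. real (\<omega> i) * x $ i)"

text \<open>The scalar \<open>c = 0\<close> is omitted for negative \<open>w\<close>, where its power is not defined.
  The zero function is homogeneous of every weight.\<close>

definition weight_homogeneous :: "('k \<Rightarrow> nat) \<Rightarrow> int \<Rightarrow> (real^'k \<Rightarrow> real) \<Rightarrow> bool" where
  "weight_homogeneous \<omega> w f \<longleftrightarrow> smooth f \<and>
     (\<forall>c x. c \<noteq> 0 \<or> 0 \<le> w \<longrightarrow> f (dilation \<omega> c x) = c powi w * f x)"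

text \<open>The \<open>(i, j)\<close> component of the Lie derivative of \<open>\<pi>\<close> along the vector field \<open>V\<close>.\<close>

definition lie_deriv_bivector :: "(real^'k \<Rightarrow> real^'k) \<Rightarrow> ('k::finite) bivector \<Rightarrow> 'k bivector" where
  "lie_deriv_bivector V \<pi> i j x =
     (\<Sum>l\<in>UNIV. V x $ l * partial_deriv l (\<pi> i j) x)
     - (\<Sum>l\<in>UNIV. \<pi> l j x * partial_deriv l (\<lambda>y. V y $ i) x)
     - (\<Sum>l\<in>UNIV. \<pi> i l x * partial_deriv l (\<lambda>y. V y $ j) x)"

definition weight_homogeneous_bivector :: "('k::finite \<Rightarrow> nat) \<Rightarrow> int \<Rightarrow> 'k bivector \<Rightarrow> bool" where
  "weight_homogeneous_bivector \<omega> w \<pi> \<longleftrightarrow>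
     (\<forall>i j x. lie_deriv_bivector (euler_field \<omega>) \<pi> i j x = of_int w * \<pi> i j x)"

section \<open>Coordinate subspaces\<close>

text \<open>Coordinates are indexed by the finite type \<open>'k\<close>. The set \<open>T\<close> holds the indices of the
  coordinates along the subspace (usually written as the first \<open>r\<close> ones); the remaining
  coordinates vanish on it. Functions on the subspace are represented by functions on the whole
  space that do not depend on the coordinates outside \<open>T\<close>.\<close>

definition coord_subspace :: "'k set \<Rightarrow> (real^'k) set" where
  "coord_subspace T = {x. \<forall>i. i \<notin> T \<longrightarrow> x $ i = 0}"

definition proj_subspace :: "'k set \<Rightarrow> real^'k \<Rightarrow> real^'k" where
  "proj_subspace T x = (\<chi> i. if i \<in> T then x $ i else 0)"

definition smooth_functions_on_subspace :: "'k set \<Rightarrow> (real^'k \<Rightarrow> real) set" where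
  "smooth_functions_on_subspace T = {f. smooth f \<and> (\<forall>x. f (proj_subspace T x) = f x)}"

definition restrict_to_subspace :: "'k set \<Rightarrow> (real^'k \<Rightarrow> real) \<Rightarrow> real^'k \<Rightarrow> real" where
  "restrict_to_subspace T f x = f (proj_subspace T x)"

section \<open>Graphs\<close>

text \<open>The vertices of type I are numbered \<open>1, \<dots>, n\<close>; the two type II vertices are named after
  the functions associated to them. The edge \<open>(r, s)\<close> with \<open>s \<in> {1, 2}\<close> is the \<open>s\<close>-th
  edge emitted by the type I vertex \<open>r\<close>. Hence each type I vertex emits exactly two ordered edges
  and type II vertices emit none, and a graph is determined by the targets and colours of its edges.\<close>

datatype vertex = Type_I nat | Type_II_F | Type_II_G

datatype colour = Plus | Minus

type_synonym edge = "nat \<times> nat"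

record graph =
  target :: "edge \<Rightarrow> vertex"
  colour :: "edge \<Rightarrow> colour"

definition source :: "edge \<Rightarrow> vertex" where
  "source e = Type_I (fst e)"

definition vertices :: "nat \<Rightarrow> vertex set" where
  "vertices n = Type_I ` {1..n} \<union> {Type_II_F, Type_II_G}"

definition edge_list :: "nat \<Rightarrow> edge list" where
  "edge_list n = List.product [1..<Suc n] [1, 2]"

abbreviation edges :: "nat \<Rightarrow> edge set" where
  "edges n \<equiv> set (edge_list n)"

definition Q2 :: "nat \<Rightarrow> graph set" where
  "Q2 n = {\<Gamma>.
     (\<forall>e\<in>edges n. target \<Gamma> e \<in> vertices n \<and> target \<Gamma> e \<noteq> source e) \<and>
     (\<forall>e\<in>edges n. \<forall>e'\<in>edges n.
        colour \<Gamma> e = colour \<Gamma> e' \<and> source e = source e' \<and> target \<Gamma> e = target \<Gamma> e' \<longrightarrow> e = e')}"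

definition incoming :: "nat \<Rightarrow> graph \<Rightarrow> vertex \<Rightarrow> edge list" where
  "incoming n \<Gamma> v = filter (\<lambda>e. target \<Gamma> e = v) (edge_list n)"

section \<open>The operator of a graph\<close>

definition labels :: "'k set \<Rightarrow> nat \<Rightarrow> graph \<Rightarrow> (edge \<Rightarrow> 'k) set" where
  "labels T n \<Gamma> = (\<Pi>\<^sub>E e\<in>edges n. case colour \<Gamma> e of Plus \<Rightarrow> T | Minus \<Rightarrow> - T)"

text \<open>The derivatives labelled by the edges ending at a vertex are taken in the order of the list of
  edges; on smooth functions this order is irrelevant.\<close>

definition vertex_deriv ::
  "nat \<Rightarrow> graph \<Rightarrow> (edge \<Rightarrow> 'k) \<Rightarrow> vertex \<Rightarrow> (real^'k \<Rightarrow> real) \<Rightarrow> real^'k \<Rightarrow> real" where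
  "vertex_deriv n \<Gamma> L v f = partial_derivs (map L (incoming n \<Gamma> v)) f"

definition graph_operator ::
  "'k set \<Rightarrow> ('k::finite) bivector \<Rightarrow> nat \<Rightarrow> graph \<Rightarrow>
     (real^'k \<Rightarrow> real) \<Rightarrow> (real^'k \<Rightarrow> real) \<Rightarrow> real^'k \<Rightarrow> real" where
  "graph_operator T \<pi> n \<Gamma> F G = restrict_to_subspace T (\<lambda>x.
     \<Sum>L\<in>labels T n \<Gamma>.
       (\<Prod>r\<in>{1..n}. vertex_deriv n \<Gamma> L (Type_I r)
            (bracket \<pi> (\<lambda>y. y $ L (r, 1)) (\<lambda>y. y $ L (r, 2))) x)
       * vertex_deriv n \<Gamma> L Type_II_F F x
       * vertex_deriv n \<Gamma> L Type_II_G G x)"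

end

theory Submission
  imports Defs
begin

text \<open>The Lie derivative condition says that the component \<open>\<pi> i j\<close> is an Euler eigenfunction of
  eigenvalue \<open>w\<^sub>\<pi> + \<omega> i + \<omega> j\<close>. Along a dilation orbit this is the equation \<open>t g' = d g\<close>, whose
  only smooth solutions on the whole line are the multiples of \<open>t ^ d\<close> (none but zero if
  \<open>d < 0\<close>), so the component scales with the right power for dilation factors of either sign.
  A derivative in direction \<open>i\<close> lowers the weight by \<open>\<omega> i\<close>. In each summand of the operator
  every edge contributes the weight of its label once positively, at its source, and once negatively,
  at its target, so only the weights of \<open>F\<close>, \<open>G\<close> and \<open>n\<close> copies of \<open>\<pi>\<close> survive.\<close>

section \<open>Smooth functions\<close>

lemma partial_derivs_simps [simp]:
  "partial_derivs [] f = f"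
  "partial_derivs (i # is) f = partial_deriv i (partial_derivs is f)"
  by (simp_all add: partial_derivs_def)

lemma partial_derivs_snoc:
  "partial_derivs (is @ [i]) f = partial_derivs is (partial_deriv i f)"
  by (simp add: partial_derivs_def)

text \<open>\<open>smooth\<close> is the largest class of differentiable functions stable under
  partial derivatives, so it suffices to exhibit one such class containing \<open>f\<close>.\<close>

lemma smooth_coinduct:
  assumes "f \<in> S"
    and "\<And>f x. f \<in> S \<Longrightarrow> f differentiable (at x)"
    and "\<And>f i. f \<in> S \<Longrightarrow> partial_deriv i f \<in> S"
  shows "smooth f"
proof -
  have "partial_derivs is f \<in> S" for "is"
    using assms(1,3) by (induction "is") auto
  then show ?thesis
    unfolding smooth_def using assms(2) by blast
qed

lemma smooth_differentiable: "smooth f \<Longrightarrow> f differentiable (at x)"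
  unfolding smooth_def by (drule spec[where x = "[]"]) simp

lemma smooth_partial_deriv: "smooth f \<Longrightarrow> smooth (partial_deriv i f)"
  unfolding smooth_def by (simp flip: partial_derivs_snoc)

lemma smooth_partial_derivs: "smooth f \<Longrightarrow> smooth (partial_derivs is f)"
  by (induction "is") (auto intro: smooth_partial_deriv)

section \<open>Partial derivatives and the total derivative\<close>

lemma partial_deriv_eqI:
  fixes f :: "real^'k::finite \<Rightarrow> real"
  assumes "(f has_derivative D) (at x)"
  shows "partial_deriv i f x = D (axis i 1)"
proof -
  have "((\<lambda>t::real. x + t *\<^sub>R axis i 1) has_derivative (\<lambda>t. t *\<^sub>R axis i 1)) (at 0)"
    by (auto intro!: derivative_eq_intros)
  moreover have "(f has_derivative D) (at (x + 0 *\<^sub>R axis i 1))"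
    using assms by simp
  ultimately have "((\<lambda>t::real. f (x + t *\<^sub>R axis i 1)) has_derivative (\<lambda>t. D (t *\<^sub>R axis i 1))) (at 0)"
    by (rule has_derivative_compose)
  moreover have "D (t *\<^sub>R axis i 1) = D (axis i 1) * t" for t
    using linear_cmul[OF has_derivative_linear[OF assms]] by simp
  ultimately have "((\<lambda>t::real. f (x + t *\<^sub>R axis i 1)) has_field_derivative D (axis i 1)) (at 0)"
    by (simp add: has_field_derivative_def)
  then show ?thesis
    unfolding partial_deriv_def by (rule DERIV_imp_deriv)
qed

text \<open>A linear map is determined by its values on the basis vectors. This puts the chain rule
  in coordinates, as needed for projections and dilations.\<close>

lemma has_derivative_partial_deriv:
  fixes f :: "real^'k::finite \<Rightarrow> real"
  assumes "f differentiable (at x)"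
  shows "(f has_derivative (\<lambda>v. \<Sum>i\<in>UNIV. v $ i * partial_deriv i f x)) (at x)"
proof -
  obtain D where D: "(f has_derivative D) (at x)"
    using assms unfolding differentiable_def by blast
  have "D v = (\<Sum>i\<in>UNIV. v $ i * partial_deriv i f x)" for v
  proof -
    have "D v = D (\<Sum>i\<in>UNIV. v $ i *\<^sub>R axis i 1)"
      by (simp add: basis_expansion scalar_mult_eq_scaleR[symmetric])
    also have "\<dots> = (\<Sum>i\<in>UNIV. v $ i * D (axis i 1))"
      using has_derivative_linear[OF D] by (simp add: linear_sum linear_cmul)
    finally show ?thesis
      by (simp add: partial_deriv_eqI[OF D])
  qed
  then have "D = (\<lambda>v. \<Sum>i\<in>UNIV. v $ i * partial_deriv i f x)"
    by blast
  then show ?thesis using D by simp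
qed

lemma partial_deriv_const [simp]: "partial_deriv i (\<lambda>x. c) = (\<lambda>x. 0)"
  by (simp add: partial_deriv_def fun_eq_iff)

lemma partial_deriv_coord:
  "partial_deriv i (\<lambda>x::real^'k::finite. a * x $ j) = (\<lambda>x. if i = j then a else 0)"
proof
  fix x :: "real^'k"
  have "((\<lambda>x. a * x $ j) has_derivative (\<lambda>x. a * x $ j)) (at x)"
    by (auto intro!: derivative_eq_intros bounded_linear.has_derivative[OF bounded_linear_vec_nth])
  from partial_deriv_eqI[OF this]
  show "partial_deriv i (\<lambda>x. a * x $ j) x = (if i = j then a else 0)"
    by (simp add: axis_def)
qed

lemma partial_deriv_add:
  fixes f g :: "real^'k::finite \<Rightarrow> real"
  assumes "f differentiable (at x)" "g differentiable (at x)"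
  shows "partial_deriv i (\<lambda>x. f x + g x) x = partial_deriv i f x + partial_deriv i g x"
proof -
  obtain D E where "(f has_derivative D) (at x)" "(g has_derivative E) (at x)"
    using assms unfolding differentiable_def by blast
  then show ?thesis
    by (simp add: partial_deriv_eqI[OF has_derivative_add] partial_deriv_eqI)
qed

lemma partial_deriv_mult:
  fixes f g :: "real^'k::finite \<Rightarrow> real"
  assumes "f differentiable (at x)" "g differentiable (at x)"
  shows "partial_deriv i (\<lambda>x. f x * g x) x = f x * partial_deriv i g x + partial_deriv i f x * g x"
proof -
  obtain D E where "(f has_derivative D) (at x)" "(g has_derivative E) (at x)"
    using assms unfolding differentiable_def by blast
  then show ?thesis
    by (simp add: partial_deriv_eqI[OF has_derivative_mult] partial_deriv_eqI)
qed

section \<open>Closure properties of smooth functions\<close>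

lemma smooth_const: "smooth (\<lambda>x. c)"
  by (rule smooth_coinduct[where S = "range (\<lambda>c x. c)"]) auto

text \<open>A stable class for \<open>smooth_coinduct\<close>: the Leibniz rule turns a product into
  a sum of products, so both closures are imposed together.\<close>

inductive_set smooth_algebra :: "(real^'k \<Rightarrow> real) set" where
  smooth: "smooth f \<Longrightarrow> f \<in> smooth_algebra"
| add: "f \<in> smooth_algebra \<Longrightarrow> g \<in> smooth_algebra \<Longrightarrow> (\<lambda>x. f x + g x) \<in> smooth_algebra"
| mult: "f \<in> smooth_algebra \<Longrightarrow> g \<in> smooth_algebra \<Longrightarrow> (\<lambda>x. f x * g x) \<in> smooth_algebra"

lemma smooth_algebra_differentiable: "f \<in> smooth_algebra \<Longrightarrow> f differentiable (at x)"
  by (induction rule: smooth_algebra.induct)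
    (auto intro: smooth_differentiable differentiable_add differentiable_mult)

lemma smooth_algebra_imp_smooth:
  assumes "f \<in> smooth_algebra"
  shows "smooth (f :: real^'k::finite \<Rightarrow> real)"
proof (rule smooth_coinduct[OF assms smooth_algebra_differentiable])
  fix f :: "real^'k \<Rightarrow> real" and i
  assume "f \<in> smooth_algebra"
  then show "partial_deriv i f \<in> smooth_algebra"
  proof induction
    case (smooth f)
    then show ?case by (intro smooth_algebra.smooth smooth_partial_deriv)
  next
    case (add f g)
    then have "partial_deriv i (\<lambda>x. f x + g x) = (\<lambda>x. partial_deriv i f x + partial_deriv i g x)"
      by (simp add: fun_eq_iff partial_deriv_add smooth_algebra_differentiable)
    with add show ?case by (simp add: smooth_algebra.add)
  next
    case (mult f g)
    then have "partial_deriv i (\<lambda>x. f x * g x)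
        = (\<lambda>x. f x * partial_deriv i g x + partial_deriv i f x * g x)"
      by (simp add: fun_eq_iff partial_deriv_mult smooth_algebra_differentiable)
    with mult show ?case by (simp add: smooth_algebra.add smooth_algebra.mult)
  qed
qed

lemma smooth_add:
  fixes f g :: "real^'k::finite \<Rightarrow> real"
  shows "smooth f \<Longrightarrow> smooth g \<Longrightarrow> smooth (\<lambda>x. f x + g x)"
  by (rule smooth_algebra_imp_smooth[OF smooth_algebra.add[OF smooth_algebra.smooth smooth_algebra.smooth]])

lemma smooth_mult:
  fixes f g :: "real^'k::finite \<Rightarrow> real"
  shows "smooth f \<Longrightarrow> smooth g \<Longrightarrow> smooth (\<lambda>x. f x * g x)"
  by (rule smooth_algebra_imp_smooth[OF smooth_algebra.mult[OF smooth_algebra.smooth smooth_algebra.smooth]])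

lemma smooth_sum:
  fixes f :: "'a \<Rightarrow> real^'k::finite \<Rightarrow> real"
  shows "(\<And>a. a \<in> A \<Longrightarrow> smooth (f a)) \<Longrightarrow> smooth (\<lambda>x. \<Sum>a\<in>A. f a x)"
  by (induction A rule: infinite_finite_induct) (auto simp: smooth_const smooth_add)

lemma smooth_prod:
  fixes f :: "'a \<Rightarrow> real^'k::finite \<Rightarrow> real"
  shows "(\<And>a. a \<in> A \<Longrightarrow> smooth (f a)) \<Longrightarrow> smooth (\<lambda>x. \<Prod>a\<in>A. f a x)"
  by (induction A rule: infinite_finite_induct) (auto simp: smooth_const smooth_mult)

section \<open>Restriction to a coordinate subspace\<close>

lemma bounded_linear_proj_subspace:
  "bounded_linear (proj_subspace T :: real^'k::finite \<Rightarrow> _)"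
  unfolding linear_conv_bounded_linear[symmetric]
  by (rule linearI) (auto simp: proj_subspace_def vec_eq_iff)

lemma proj_subspace_idem: "proj_subspace T (proj_subspace T x) = proj_subspace T x"
  by (simp add: proj_subspace_def vec_eq_iff)

lemma smooth_restrict_to_subspace:
  fixes f :: "real^'k::finite \<Rightarrow> real"
  assumes "smooth f"
  shows "smooth (restrict_to_subspace T f)"
proof (rule smooth_coinduct)
  \<comment> \<open>A derivative in a direction outside \<open>T\<close> kills every restriction,
    hence the explicit zero function; one in a direction in \<open>T\<close> commutes with
    restriction.\<close>
  let ?S = "insert (\<lambda>x. 0) (restrict_to_subspace T ` Collect smooth) :: (real^'k \<Rightarrow> real) set"
  show "restrict_to_subspace T f \<in> ?S" using assms by simp
  have comp: "(restrict_to_subspace T h has_derivative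
      (\<lambda>v. \<Sum>i\<in>UNIV. proj_subspace T v $ i * partial_deriv i h (proj_subspace T x))) (at x)"
    if "smooth h" for h :: "real^'k \<Rightarrow> real" and x
    unfolding restrict_to_subspace_def
    by (rule has_derivative_compose[OF
          bounded_linear_imp_has_derivative[OF bounded_linear_proj_subspace]
          has_derivative_partial_deriv[OF smooth_differentiable[OF that]]])
  show "g differentiable (at x)" if "g \<in> ?S" for g x
    using that comp by (auto intro: differentiableI)
  have "partial_deriv i (restrict_to_subspace T h)
      = (if i \<in> T then restrict_to_subspace T (partial_deriv i h) else (\<lambda>x. 0))"
    if "smooth h" for h :: "real^'k \<Rightarrow> real" and i
  proof
    fix x
    have "partial_deriv i (restrict_to_subspace T h) x
        = (\<Sum>j\<in>UNIV. proj_subspace T (axis i 1) $ j * partial_deriv j h (proj_subspace T x))"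
      by (rule partial_deriv_eqI[OF comp[OF that]])
    also have "\<dots> = (\<Sum>j\<in>UNIV. if j = i then (if i \<in> T then partial_deriv i h (proj_subspace T x) else 0) else 0)"
      by (rule sum.cong) (auto simp: proj_subspace_def axis_def)
    finally show "partial_deriv i (restrict_to_subspace T h) x
        = (if i \<in> T then restrict_to_subspace T (partial_deriv i h) else (\<lambda>x. 0)) x"
      by (simp add: restrict_to_subspace_def)
  qed
  then show "partial_deriv i g \<in> ?S" if "g \<in> ?S" for g i
    using that by (auto simp: smooth_partial_deriv)
qed

section \<open>Homogeneity along dilations\<close>

text \<open>This is the chain rule along a dilation orbit. If \<open>\<omega> l = 0\<close>, the
  truncated exponent \<open>\<omega> l - 1\<close> is harmless because the factor
  \<open>real (\<omega> l)\<close> vanishes.\<close>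

lemma dilation_derivative:
  fixes f :: "real^'k::finite \<Rightarrow> real"
  assumes "smooth f"
  shows "((\<lambda>t. f (dilation \<omega> t x)) has_real_derivative
    (\<Sum>l\<in>UNIV. real (\<omega> l) * t ^ (\<omega> l - 1) * x $ l * partial_deriv l f (dilation \<omega> t x))) (at t)"
proof -
  have "((\<lambda>t. dilation \<omega> t x) has_derivative
      (\<lambda>s. \<chi> l. s * (real (\<omega> l) * t ^ (\<omega> l - 1) * x $ l))) (at t)"
    unfolding dilation_def
    by (subst has_derivative_componentwise_within)
      (auto simp: Basis_vec_def inner_axis intro!: derivative_eq_intros)
  from has_derivative_compose[OF this has_derivative_partial_deriv[OF smooth_differentiable[OF assms]]]
  show ?thesis
    unfolding has_field_derivative_def
    by (rule has_derivative_eq_rhs) (simp add: fun_eq_iff sum_distrib_left mult_ac)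
qed

text \<open>Differentiating along an orbit yields sums of terms with powers of \<open>t\<close> in
  front. Allowing both makes the class closed under differentiation, so its members are infinitely
  differentiable on the whole line.\<close>

inductive_set dilation_orbits :: "('k \<Rightarrow> nat) \<Rightarrow> real^'k \<Rightarrow> (real \<Rightarrow> real) set"
  for \<omega> x where
  base: "smooth f \<Longrightarrow> (\<lambda>t. t ^ m * f (dilation \<omega> t x)) \<in> dilation_orbits \<omega> x"
| add: "g \<in> dilation_orbits \<omega> x \<Longrightarrow> h \<in> dilation_orbits \<omega> x \<Longrightarrow> (\<lambda>t. g t + h t) \<in> dilation_orbits \<omega> x"

lemma dilation_orbits_sum:
  assumes "\<And>a. a \<in> A \<Longrightarrow> g a \<in> dilation_orbits \<omega> x"
  shows "(\<lambda>t. \<Sum>a\<in>A. g a t) \<in> dilation_orbits \<omega> x"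
proof -
  have "(\<lambda>t. 0) \<in> dilation_orbits \<omega> x"
    using dilation_orbits.base[OF smooth_const[of 0], of 0] by simp
  then show ?thesis
    using assms by (induction A rule: infinite_finite_induct) (auto intro: dilation_orbits.add)
qed

lemma dilation_orbits_derivative:
  fixes \<omega> :: "'k::finite \<Rightarrow> nat"
  assumes "g \<in> dilation_orbits \<omega> x"
  shows "\<exists>g'\<in>dilation_orbits \<omega> x. \<forall>t. (g has_real_derivative g' t) (at t)"
  using assms
proof induction
  case (base f m)
  \<comment> \<open>For \<open>m = 0\<close> the exponent \<open>m - 1\<close> truncates to
    \<open>0\<close>, and the factor \<open>real m\<close> removes that term.\<close>
  let ?g' = "\<lambda>t. t ^ (m - 1) * (real m * f (dilation \<omega> t x))
      + (\<Sum>l\<in>UNIV. t ^ (m + (\<omega> l - 1)) * ((real (\<omega> l) * x $ l) * partial_deriv l f (dilation \<omega> t x)))"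
  have "?g' \<in> dilation_orbits \<omega> x"
    using base
    by (intro dilation_orbits.add dilation_orbits_sum
        dilation_orbits.base[where f = "\<lambda>y. real m * f y"]
        dilation_orbits.base[where f = "\<lambda>y. (real (\<omega> l) * x $ l) * partial_deriv l f y" for l]
        smooth_mult smooth_const smooth_partial_deriv)
  moreover have "((\<lambda>t. t ^ m * f (dilation \<omega> t x)) has_real_derivative ?g' t) (at t)" for t
    using DERIV_mult[OF DERIV_pow[of m t UNIV] dilation_derivative[OF base, where \<omega> = \<omega> and t = t and x = x]]
    by (rule DERIV_cong) (simp add: sum_distrib_left sum_distrib_right power_add mult_ac)
  ultimately show ?case by (intro bexI[where x = ?g']) auto
next
  case (add g h)
  then obtain g' h' where "g' \<in> dilation_orbits \<omega> x" "h' \<in> dilation_orbits \<omega> x"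
    and "\<forall>t. (g has_real_derivative g' t) (at t)" "\<forall>t. (h has_real_derivative h' t) (at t)"
    by blast
  then show ?case
    by (intro bexI[where x = "\<lambda>t. g' t + h' t"] allI DERIV_add dilation_orbits.add) auto
qed

text \<open>Differentiating \<open>t g' = d g\<close> gives \<open>t g'' = (d - 1) g'\<close>, so smoothness at the origin
  propagates down to \<open>d = 0\<close>; this is what links the two half-lines \<open>t > 0\<close> and \<open>t < 0\<close>.\<close>

lemma euler_ode_nat:
  fixes g :: "real \<Rightarrow> real"
  assumes closed: "\<And>g. g \<in> S \<Longrightarrow> \<exists>g'\<in>S. \<forall>t. (g has_real_derivative g' t) (at t)"
    and "g \<in> S" and "\<And>t. (g has_real_derivative g' t) (at t)" and "\<And>t. t * g' t = real d * g t"
  shows "g t = t ^ d * g 1"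
  using assms(2-)
proof (induction d arbitrary: g g' t)
  case 0
  obtain g1 where g1: "g1 \<in> S" "\<And>t. (g has_real_derivative g1 t) (at t)"
    using closed[OF 0(1)] by blast
  \<comment> \<open>Derivatives are unique, so the given \<open>g'\<close> lies in \<open>S\<close>
    and can be differentiated again.\<close>
  have eq: "g1 = g'"
    by (rule ext) (rule DERIV_unique[OF g1(2) 0(2)])
  obtain g2 where "\<And>t. (g' has_real_derivative g2 t) (at t)"
    using closed[OF g1(1)] eq by blast
  then have cont: "(g' \<longlongrightarrow> g' 0) (at 0)"
    using DERIV_isCont isContD by blast
  \<comment> \<open>With \<open>d = 0\<close> the equation reads \<open>t * g' t = 0\<close>. It
    says nothing at the origin, where continuity of \<open>g'\<close> decides.\<close>
  have zero: "g' t = 0" if "t \<noteq> 0" for t using 0(3)[of t] that by simp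
  then have "\<forall>\<^sub>F t in at 0. g' t = 0"
    by (auto simp: eventually_at_filter)
  then have "(g' \<longlongrightarrow> 0) (at 0)"
    by (rule tendsto_eventually)
  with cont have "g' 0 = 0"
    using tendsto_unique trivial_limit_at by blast
  with zero have "g' t = 0" for t by (cases "t = 0") auto
  then have "g t = g 1"
    using 0(2) DERIV_isconst_all[of g t 1] by simp
  then show ?case by simp
next
  case (Suc d)
  obtain g1 where g1: "g1 \<in> S" "\<And>t. (g has_real_derivative g1 t) (at t)"
    using closed[OF Suc.prems(1)] by blast
  have eq: "g1 = g'"
    by (rule ext) (rule DERIV_unique[OF g1(2) Suc.prems(2)])
  obtain g2 where g2: "\<And>t. (g' has_real_derivative g2 t) (at t)"
    using closed[OF g1(1)] eq by blast
  \<comment> \<open>The function \<open>t * g' t\<close> is differentiated in two ways, by the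
    Leibniz rule and through the equation.\<close>
  have "t * g2 t = real d * g' t" for t
  proof -
    have "((\<lambda>t. t * g' t) has_real_derivative (1 * g' t + g2 t * t)) (at t)"
      by (intro DERIV_mult DERIV_ident g2)
    moreover have "((\<lambda>t. t * g' t) has_real_derivative (real (Suc d) * g' t)) (at t)"
      unfolding Suc.prems(3) by (intro DERIV_cmult Suc.prems)
    ultimately have "1 * g' t + g2 t * t = real (Suc d) * g' t"
      by (rule DERIV_unique)
    then show ?thesis by (simp add: algebra_simps)
  qed
  moreover have "g' \<in> S" using g1(1) eq by simp
  ultimately have "g' t = t ^ d * g' 1"
    by (intro Suc.IH[where g = g' and g' = g2] g2)
  \<comment> \<open>The equation at \<open>t\<close> and at \<open>1\<close> trades
    \<open>g'\<close> for \<open>Suc d\<close> times \<open>g\<close>; the nonzero factor then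
    cancels.\<close>
  then have "real (Suc d) * g t = real (Suc d) * (t ^ Suc d * g 1)"
    using Suc.prems(3)[of t] Suc.prems(3)[of 1] by (simp add: algebra_simps)
  then show ?case
    by (simp only: mult_cancel_left) simp
qed

text \<open>The integrating factor \<open>t ^ d\<close> makes \<open>t ^ d * g t\<close> constant,
  and its value at the origin is zero. This settles \<open>t \<noteq> 0\<close>; at the origin the
  equation itself gives \<open>g 0 = 0\<close>.\<close>

lemma euler_ode_neg:
  fixes g :: "real \<Rightarrow> real"
  assumes "\<And>t. (g has_real_derivative g' t) (at t)" and "\<And>t. t * g' t = - real d * g t" and "0 < d"
  shows "g t = 0"
proof -
  have "((\<lambda>t. t ^ d * g t) has_real_derivative 0) (at t)" for t
  proof -
    have "((\<lambda>t. t ^ d * g t) has_real_derivative (real d * t ^ (d - 1) * g t + g' t * t ^ d)) (at t)"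
      using assms(1) by (auto intro!: derivative_eq_intros)
    moreover have pow: "t ^ d = t ^ (d - 1) * t"
      using power_minus_mult[OF assms(3)] by (rule sym)
    have "real d * t ^ (d - 1) * g t + g' t * t ^ d = t ^ (d - 1) * (real d * g t + t * g' t)"
      by (simp only: pow distrib_left mult_ac)
    ultimately show ?thesis using assms(2) by simp
  qed
  then have "\<forall>t. ((\<lambda>t. t ^ d * g t) has_real_derivative 0) (at t)" ..
  from DERIV_isconst_all[OF this, of t 0] have "t ^ d * g t = 0 ^ d * g 0" .
  moreover have "g 0 = 0" using assms(2)[of 0] assms(3) by simp
  ultimately show ?thesis using assms(3) by (cases "t = 0") auto
qed

text \<open>This is the converse of Euler's identity: \<open>f\<close> is restricted to a dilation
  orbit and compared at the parameters \<open>c\<close> and \<open>1\<close>, the latter returning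
  \<open>f x\<close>.\<close>

lemma euler_imp_homogeneous:
  fixes f :: "real^'k::finite \<Rightarrow> real"
  assumes pos: "\<forall>i. 0 < \<omega> i" and "smooth f"
    and euler: "\<And>x. (\<Sum>l\<in>UNIV. real (\<omega> l) * x $ l * partial_deriv l f x) = of_int d * f x"
  shows "f (dilation \<omega> c x) = c powi d * f x"
proof -
  define g where "g t = f (dilation \<omega> t x)" for t
  define g' where "g' t = (\<Sum>l\<in>UNIV. real (\<omega> l) * t ^ (\<omega> l - 1) * x $ l * partial_deriv l f (dilation \<omega> t x))" for t
  have deriv: "(g has_real_derivative g' t) (at t)" for t
    unfolding g_def g'_def by (rule dilation_derivative[OF assms(2)])
  have ode: "t * g' t = of_int d * g t" for t
  proof -
    \<comment> \<open>Positive weights let the extra factor \<open>t\<close> restore the full power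
      lost in the chain rule.\<close>
    have "t ^ \<omega> l = t * t ^ (\<omega> l - 1)" for l
      using power_minus_mult[OF pos[rule_format], of t l] by (metis mult.commute)
    then have "t * g' t = (\<Sum>l\<in>UNIV. real (\<omega> l) * dilation \<omega> t x $ l * partial_deriv l f (dilation \<omega> t x))"
      unfolding g'_def sum_distrib_left
      by (intro sum.cong refl) (simp only: dilation_def vec_lambda_beta mult_ac)
    then show ?thesis unfolding g_def euler .
  qed
  have orbit: "g \<in> dilation_orbits \<omega> x"
    using dilation_orbits.base[OF assms(2), of 0] by (simp add: g_def[abs_def])
  have "g c = c powi d * g 1"
  proof (cases "0 \<le> d")
    case True
    then have "t * g' t = real (nat d) * g t" for t using ode by simp
    then have "g c = c ^ nat d * g 1"
      by (intro euler_ode_nat[where S = "dilation_orbits \<omega> x" and g = g and g' = g']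
          dilation_orbits_derivative orbit deriv)
    with True show ?thesis by (simp add: power_int_def)
  next
    case False
    \<comment> \<open>For negative \<open>d\<close> the function vanishes along the whole orbit, so
      both sides are zero.\<close>
    then have "t * g' t = - real (nat (- d)) * g t" for t using ode by simp
    then have "g t = 0" for t
      using False by (intro euler_ode_neg[where g = g and g' = g' and d = "nat (- d)"] deriv) auto
    then show ?thesis by simp
  qed
  then show ?thesis by (simp add: g_def dilation_def)
qed

section \<open>Homogeneity at \<open>c = 0\<close> and under differentiation\<close>

lemma isCont_dilation_origin:
  assumes "smooth f"
  shows "isCont (\<lambda>c. f (dilation \<omega> c (x::real^'k::finite))) 0"
  by (rule DERIV_isCont) (rule dilation_derivative[OF assms])

text \<open>Both sides are continuous in \<open>c\<close> at \<open>0\<close> when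
  \<open>0 \<le> w\<close>, so agreement for \<open>c \<noteq> 0\<close> extends. Weights can thus
  be computed with nonzero \<open>c\<close> only, where integer powers multiply freely even if
  intermediate weights are negative.\<close>

lemma weight_homogeneousI:
  fixes f :: "real^'k::finite \<Rightarrow> real"
  assumes "smooth f" and hom: "\<And>c x. c \<noteq> 0 \<Longrightarrow> f (dilation \<omega> c x) = c powi w * f x"
  shows "weight_homogeneous \<omega> w f"
proof -
  have "f (dilation \<omega> 0 x) = 0 powi w * f x" if "0 \<le> w" for x
  proof -
    have pow: "c powi w = c ^ nat w" for c :: real
      using that by (simp add: power_int_def)
    have "((\<lambda>c. c ^ nat w * f x) \<longlongrightarrow> 0 ^ nat w * f x) (at 0)"
      by (intro tendsto_intros)
    then have "((\<lambda>c. f (dilation \<omega> c x)) \<longlongrightarrow> 0 ^ nat w * f x) (at 0)"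
      by (rule Lim_transform_eventually) (auto simp: eventually_at_filter hom pow)
    moreover have "((\<lambda>c. f (dilation \<omega> c x)) \<longlongrightarrow> f (dilation \<omega> 0 x)) (at 0)"
      using isCont_dilation_origin[OF assms(1)] by (simp add: isCont_def)
    ultimately show ?thesis
      unfolding pow using tendsto_unique trivial_limit_at by blast
  qed
  then show ?thesis
    unfolding weight_homogeneous_def using assms by metis
qed

text \<open>The homogeneity identity is differentiated in direction \<open>i\<close>. The dilation
  scales that axis by \<open>c ^ \<omega> i\<close>, and dividing by this factor lowers the
  weight.\<close>

lemma partial_deriv_dilation:
  fixes f :: "real^'k::finite \<Rightarrow> real"
  assumes "smooth f" and "c \<noteq> 0" and hom: "\<And>x. f (dilation \<omega> c x) = c powi w * f x"
  shows "partial_deriv i f (dilation \<omega> c x) = c powi (w - int (\<omega> i)) * partial_deriv i f x"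
proof -
  have dil: "bounded_linear (dilation \<omega> c :: real^'k \<Rightarrow> _)"
    unfolding linear_conv_bounded_linear[symmetric]
    by (rule linearI) (auto simp: dilation_def vec_eq_iff algebra_simps)
  have "((\<lambda>x. f (dilation \<omega> c x)) has_derivative
      (\<lambda>v. \<Sum>j\<in>UNIV. dilation \<omega> c v $ j * partial_deriv j f (dilation \<omega> c x))) (at x)"
    by (rule has_derivative_compose[OF bounded_linear_imp_has_derivative[OF dil]
          has_derivative_partial_deriv[OF smooth_differentiable[OF assms(1)]]])
  from partial_deriv_eqI[OF this, of i]
  have "partial_deriv i (\<lambda>x. f (dilation \<omega> c x)) x
      = (\<Sum>j\<in>UNIV. dilation \<omega> c (axis i 1) $ j * partial_deriv j f (dilation \<omega> c x))" .
  also have "\<dots> = (\<Sum>j\<in>UNIV. if j = i then c ^ \<omega> i * partial_deriv i f (dilation \<omega> c x) else 0)"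
    by (rule sum.cong) (auto simp: dilation_def axis_def)
  finally have "c ^ \<omega> i * partial_deriv i f (dilation \<omega> c x)
      = partial_deriv i (\<lambda>x. c powi w * f x) x"
    by (simp add: hom)
  also have "\<dots> = c powi w * partial_deriv i f x"
    by (simp add: partial_deriv_mult smooth_differentiable assms(1))
  finally show ?thesis
    using assms(2) by (simp add: power_int_diff field_simps)
qed

lemma partial_derivs_dilation:
  fixes f :: "real^'k::finite \<Rightarrow> real"
  assumes "smooth f" and "c \<noteq> 0" and "\<And>x. f (dilation \<omega> c x) = c powi w * f x"
  shows "partial_derivs is f (dilation \<omega> c x)
    = c powi (w - (\<Sum>i\<leftarrow>is. int (\<omega> i))) * partial_derivs is f x"
proof (induction "is" arbitrary: x)
  case Nil
  then show ?case using assms(3) by simp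
next
  case (Cons i "is")
  have "w - (\<Sum>j\<leftarrow>i # is. int (\<omega> j)) = (w - (\<Sum>j\<leftarrow>is. int (\<omega> j))) - int (\<omega> i)"
    by simp
  with partial_deriv_dilation[where f = "partial_derivs is f", OF smooth_partial_derivs[OF assms(1)] assms(2) Cons.IH]
  show ?case by (simp only: partial_derivs_simps)
qed

section \<open>Weights of graph operators\<close>

text \<open>With this, each type I vertex of a labelled graph carries a single component of
  \<open>\<pi>\<close>.\<close>

lemma bracket_coords:
  fixes \<pi> :: "('k::finite) bivector"
  shows "bracket \<pi> (\<lambda>y. y $ a) (\<lambda>y. y $ b) = \<pi> a b"
proof
  fix x
  have coord: "partial_deriv i (\<lambda>y. y $ j) x = (if i = j then 1 else 0)" for i j :: 'k
    using partial_deriv_coord[of i 1 j] by simp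
  have "\<pi> i j x * (if i = a then 1 else 0) * (if j = b then 1 else 0)
      = (if j = b then if i = a then \<pi> i b x else 0 else 0)" for i j
    by simp
  then have "bracket \<pi> (\<lambda>y. y $ a) (\<lambda>y. y $ b) x
      = (\<Sum>i\<in>UNIV. \<Sum>j\<in>UNIV. if j = b then if i = a then \<pi> i b x else 0 else 0)"
    by (simp only: bracket_def coord)
  then show "bracket \<pi> (\<lambda>y. y $ a) (\<lambda>y. y $ b) x = \<pi> a b x" by simp
qed

text \<open>The Euler field has a diagonal Jacobian with the weights as entries. The two correction
  terms of the Lie derivative therefore only shift the eigenvalue, by \<open>\<omega> i\<close> and
  \<open>\<omega> j\<close>.\<close>

lemma bivector_component_dilation:
  fixes \<pi> :: "('k::finite) bivector"
  assumes "\<forall>i. 0 < \<omega> i" and "smooth (\<pi> i j)" and "weight_homogeneous_bivector \<omega> w \<pi>"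
  shows "\<pi> i j (dilation \<omega> c x) = c powi (w + int (\<omega> i) + int (\<omega> j)) * \<pi> i j x"
proof (rule euler_imp_homogeneous[OF assms(1,2)])
  fix x
  have euler: "partial_deriv l (\<lambda>y. euler_field \<omega> y $ a) x = (if l = a then real (\<omega> a) else 0)" for l a
    by (simp add: euler_field_def partial_deriv_coord)
  have "(\<Sum>l\<in>UNIV. \<pi> l j x * partial_deriv l (\<lambda>y. euler_field \<omega> y $ i) x)
      = (\<Sum>l\<in>UNIV. if l = i then \<pi> i j x * real (\<omega> i) else 0)"
    unfolding euler by (intro sum.cong) auto
  moreover have "(\<Sum>l\<in>UNIV. \<pi> i l x * partial_deriv l (\<lambda>y. euler_field \<omega> y $ j) x)
      = (\<Sum>l\<in>UNIV. if l = j then \<pi> i j x * real (\<omega> j) else 0)"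
    unfolding euler by (intro sum.cong) auto
  moreover have "lie_deriv_bivector (euler_field \<omega>) \<pi> i j x = of_int w * \<pi> i j x"
    using assms(3) by (simp add: weight_homogeneous_bivector_def)
  ultimately show "(\<Sum>l\<in>UNIV. real (\<omega> l) * x $ l * partial_deriv l (\<pi> i j) x)
      = of_int (w + int (\<omega> i) + int (\<omega> j)) * \<pi> i j x"
    unfolding lie_deriv_bivector_def by (simp add: euler_field_def algebra_simps)
qed

section \<open>Counting edges by source and by target\<close>

lemma sum_list_incoming:
  fixes h :: "edge \<Rightarrow> int"
  shows "(\<Sum>e\<leftarrow>incoming n \<Gamma> v. h e) = (\<Sum>e | e \<in> edges n \<and> target \<Gamma> e = v. h e)"
proof -
  have "distinct (edge_list n)"
    unfolding edge_list_def by (rule distinct_product) auto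
  then have "distinct (incoming n \<Gamma> v)"
    unfolding incoming_def by (rule distinct_filter)
  then have "(\<Sum>e\<leftarrow>incoming n \<Gamma> v. h e) = sum h (set (incoming n \<Gamma> v))"
    by (rule sum_list_distinct_conv_sum_set)
  moreover have "set (incoming n \<Gamma> v) = {e. e \<in> edges n \<and> target \<Gamma> e = v}"
    unfolding incoming_def by auto
  ultimately show ?thesis by simp
qed

lemma edges_eq: "edges n = {1..n} \<times> {1, 2}"
  by (auto simp: edge_list_def)

lemma sum_edges_by_source:
  fixes h :: "edge \<Rightarrow> int"
  shows "sum h (edges n) = (\<Sum>r\<in>{1..n}. h (r, 1) + h (r, 2))"
proof -
  have "sum h (edges n) = (\<Sum>r\<in>{1..n}. \<Sum>s\<in>{1, 2}. h (r, s))"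
    unfolding edges_eq by (subst sum.cartesian_product) simp
  then show ?thesis by simp
qed

text \<open>Membership in \<open>Q2 n\<close> puts every target in \<open>vertices n\<close>, so the
  fibres of \<open>target \<Gamma>\<close> over the vertices partition the edges.\<close>

lemma sum_edges_by_target:
  fixes h :: "edge \<Rightarrow> int"
  assumes "\<Gamma> \<in> Q2 n"
  shows "sum h (edges n) = (\<Sum>r\<in>{1..n}. \<Sum>e\<leftarrow>incoming n \<Gamma> (Type_I r). h e)
    + (\<Sum>e\<leftarrow>incoming n \<Gamma> Type_II_F. h e) + (\<Sum>e\<leftarrow>incoming n \<Gamma> Type_II_G. h e)"
proof -
  have "target \<Gamma> ` edges n \<subseteq> vertices n"
    using assms by (auto simp: Q2_def)
  then have "sum h (edges n) = (\<Sum>v\<in>vertices n. \<Sum>e | e \<in> edges n \<and> target \<Gamma> e = v. h e)"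
    by (intro sum.group[symmetric]) (auto simp: vertices_def)
  also have "\<dots> = (\<Sum>v\<in>vertices n. \<Sum>e\<leftarrow>incoming n \<Gamma> v. h e)"
    by (simp only: sum_list_incoming)
  also have "\<dots> = (\<Sum>v\<in>Type_I ` {1..n}. \<Sum>e\<leftarrow>incoming n \<Gamma> v. h e)
      + (\<Sum>v\<in>{Type_II_F, Type_II_G}. \<Sum>e\<leftarrow>incoming n \<Gamma> v. h e)"
    unfolding vertices_def by (rule sum.union_disjoint) auto
  also have "(\<Sum>v\<in>Type_I ` {1..n}. \<Sum>e\<leftarrow>incoming n \<Gamma> v. h e)
      = (\<Sum>r\<in>{1..n}. \<Sum>e\<leftarrow>incoming n \<Gamma> (Type_I r). h e)"
    by (subst sum.reindex) (auto simp: inj_on_def)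
  finally show ?thesis by simp
qed

lemma power_int_sum:
  fixes c :: real
  assumes "c \<noteq> 0"
  shows "(\<Prod>a\<in>A. c powi h a) = c powi (\<Sum>a\<in>A. h a)"
  using assms by (induction A rule: infinite_finite_induct) (auto simp: power_int_add)

lemma vertex_deriv_dilation:
  fixes f :: "real^'k::finite \<Rightarrow> real"
  assumes "smooth f" and "c \<noteq> 0" and "\<And>x. f (dilation \<omega> c x) = c powi w * f x"
  shows "vertex_deriv n \<Gamma> L v f (dilation \<omega> c x)
    = c powi (w - (\<Sum>e\<leftarrow>incoming n \<Gamma> v. int (\<omega> (L e)))) * vertex_deriv n \<Gamma> L v f x"
  using partial_derivs_dilation[where f = f and ?is = "map L (incoming n \<Gamma> v)", OF assms]
  by (simp add: vertex_deriv_def comp_def)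

lemma smooth_vertex_deriv: "smooth f \<Longrightarrow> smooth (vertex_deriv n \<Gamma> L v f)"
  unfolding vertex_deriv_def by (rule smooth_partial_derivs)

theorem lemma2p1:
  fixes \<omega> :: "'k::finite \<Rightarrow> nat" and \<pi> :: "'k bivector" and T :: "'k set"
    and F G :: "real^'k \<Rightarrow> real" and \<Gamma> :: graph and n :: nat
    and w\<^sub>\<pi> w\<^sub>F w\<^sub>G :: int
  assumes "\<forall>i. 0 < \<omega> i"
    and "poisson_structure \<pi>"
    and "weight_homogeneous_bivector \<omega> w\<^sub>\<pi> \<pi>"
    and "coisotropic \<pi> (coord_subspace T)"
    and "F \<in> smooth_functions_on_subspace T" and "weight_homogeneous \<omega> w\<^sub>F F"
    and "G \<in> smooth_functions_on_subspace T" and "weight_homogeneous \<omega> w\<^sub>G G"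
    and "\<Gamma> \<in> Q2 n"
  shows "graph_operator T \<pi> n \<Gamma> F G \<in> smooth_functions_on_subspace T \<and>
    weight_homogeneous \<omega> (w\<^sub>F + w\<^sub>G + int n * w\<^sub>\<pi>) (graph_operator T \<pi> n \<Gamma> F G)"
proof -
  have smooth_\<pi>: "smooth (\<pi> i j)" for i j
    using assms(2) by (simp add: poisson_structure_def bivector_field_def)
  have smooth_F: "smooth F" and smooth_G: "smooth G"
    using assms(6,8) by (simp_all add: weight_homogeneous_def)
  define summand where "summand L x =
      (\<Prod>r\<in>{1..n}. vertex_deriv n \<Gamma> L (Type_I r) (\<pi> (L (r, 1)) (L (r, 2))) x)
      * vertex_deriv n \<Gamma> L Type_II_F F x * vertex_deriv n \<Gamma> L Type_II_G G x" for L x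
  define B where "B x = (\<Sum>L\<in>labels T n \<Gamma>. summand L x)" for x
  have operator: "graph_operator T \<pi> n \<Gamma> F G = restrict_to_subspace T B"
    unfolding graph_operator_def bracket_coords B_def summand_def ..
  have "smooth B"
    unfolding B_def summand_def
    by (intro smooth_sum smooth_mult smooth_prod smooth_vertex_deriv smooth_\<pi> smooth_F smooth_G)
  then have smooth_op: "smooth (restrict_to_subspace T B)"
    by (rule smooth_restrict_to_subspace)
  have hom_summand: "summand L (dilation \<omega> c x) = c powi (w\<^sub>F + w\<^sub>G + int n * w\<^sub>\<pi>) * summand L x"
    if c: "c \<noteq> 0" for L c x
  proof -
    \<comment> \<open>\<open>h e\<close> is the weight of the label of \<open>e\<close>, and
      \<open>s v\<close> is the weight lost at \<open>v\<close> through its incoming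
      derivatives.\<close>
    define h where "h e = int (\<omega> (L e))" for e
    define s where "s v = (\<Sum>e\<leftarrow>incoming n \<Gamma> v. h e)" for v
    have "vertex_deriv n \<Gamma> L (Type_I r) (\<pi> (L (r, 1)) (L (r, 2))) (dilation \<omega> c x)
        = c powi (w\<^sub>\<pi> + h (r, 1) + h (r, 2) - s (Type_I r))
          * vertex_deriv n \<Gamma> L (Type_I r) (\<pi> (L (r, 1)) (L (r, 2))) x" for r
      unfolding h_def s_def
      by (rule vertex_deriv_dilation[OF smooth_\<pi> c
            bivector_component_dilation[OF assms(1) smooth_\<pi> assms(3)]])
    moreover have "vertex_deriv n \<Gamma> L Type_II_F F (dilation \<omega> c x)
        = c powi (w\<^sub>F - s Type_II_F) * vertex_deriv n \<Gamma> L Type_II_F F x"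
      unfolding h_def s_def using assms(6) c
      by (intro vertex_deriv_dilation) (auto simp: weight_homogeneous_def)
    moreover have "vertex_deriv n \<Gamma> L Type_II_G G (dilation \<omega> c x)
        = c powi (w\<^sub>G - s Type_II_G) * vertex_deriv n \<Gamma> L Type_II_G G x"
      unfolding h_def s_def using assms(8) c
      by (intro vertex_deriv_dilation) (auto simp: weight_homogeneous_def)
    ultimately have "summand L (dilation \<omega> c x) =
        c powi (\<Sum>r\<in>{1..n}. w\<^sub>\<pi> + h (r, 1) + h (r, 2) - s (Type_I r))
        * c powi (w\<^sub>F - s Type_II_F) * c powi (w\<^sub>G - s Type_II_G) * summand L x"
      using c by (simp add: summand_def prod.distrib power_int_sum)
    also have "\<dots> = c powi ((\<Sum>r\<in>{1..n}. w\<^sub>\<pi> + h (r, 1) + h (r, 2) - s (Type_I r))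
        + (w\<^sub>F - s Type_II_F) + (w\<^sub>G - s Type_II_G)) * summand L x"
      using c by (simp add: power_int_add)
    \<comment> \<open>The gains summed over sources and the losses summed over targets both equal
      \<open>sum h (edges n)\<close>, so they cancel.\<close>
    also have "(\<Sum>r\<in>{1..n}. w\<^sub>\<pi> + h (r, 1) + h (r, 2) - s (Type_I r))
        + (w\<^sub>F - s Type_II_F) + (w\<^sub>G - s Type_II_G) = w\<^sub>F + w\<^sub>G + int n * w\<^sub>\<pi>"
      using sum_edges_by_source[of h n] sum_edges_by_target[OF assms(9), of h]
      by (simp add: s_def sum.distrib sum_subtractf)
    finally show ?thesis .
  qed
  have "restrict_to_subspace T B (dilation \<omega> c x)
      = c powi (w\<^sub>F + w\<^sub>G + int n * w\<^sub>\<pi>) * restrict_to_subspace T B x" if "c \<noteq> 0" for c x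
  proof -
    \<comment> \<open>Both maps act coordinatewise, so homogeneity passes to the
      restriction.\<close>
    have "proj_subspace T (dilation \<omega> c x) = dilation \<omega> c (proj_subspace T x)"
      by (simp add: proj_subspace_def dilation_def vec_eq_iff)
    then show ?thesis
      by (simp add: restrict_to_subspace_def B_def hom_summand[OF that] sum_distrib_left)
  qed
  with smooth_op have "weight_homogeneous \<omega> (w\<^sub>F + w\<^sub>G + int n * w\<^sub>\<pi>) (restrict_to_subspace T B)"
    by (rule weight_homogeneousI)
  moreover have "restrict_to_subspace T B \<in> smooth_functions_on_subspace T"
    using smooth_op
    by (simp add: smooth_functions_on_subspace_def restrict_to_subspace_def proj_subspace_idem)
  ultimately show ?thesis by (simp add: operator)
qed

end
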